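(* Let $\beta,\psi_0$ be real constants, $\kappa>0$, $K\neq0$, and $I=\{r>0:1-Kr^2>0\}$. Set $\tilde{\mathcal{C}}\equiv0$, $\mathcal{A}(\psi)=\frac{5\beta}{8}\psi^2$, $\mathcal{V}(\psi)=-\frac{15K\beta}{4\kappa^2}\psi^2$, and $$A(r)=1-Kr^2,\qquad C(r)=1,\qquad \psi(r)=\frac{2\psi_0}{5K(1-Kr^2)^{5/4}} .$$ Then $E^{(1)}_{tt}=E^{(1)}_{rr}=E^{(1)}_{\vartheta\vartheta}=E^{(1)}_{\psi}=0$ hold on $I$.
   Context: Metric ansatz ${\rm d}s^2=A(r)^2{\rm d}t^2-\frac{C(r)^2}{A(r)^2}{\rm d}r^2-r^2{\rm d}\Omega^2$, $\psi=\psi(r)$. Primes on $A,C,\psi$ are $r$-derivatives; $\mathcal{A}',\tilde{\mathcal{C}}',\tilde{\mathcal{C}}'',\mathcal{V}'$ are $\psi$-derivatives evaluated at $\psi(r)$. The real-tetrad reduced vacuum field equations of the scalar-torsion theory are: $E^{(1)}_{tt}:\ 0=\mathcal{A}\frac{A^2(-2rACA'-A^2(C-2rC')+C^3)}{r^2C^3}+\tilde{\mathcal{C}}'\Big(\frac{A^4\psi''}{C^2}-\frac{A^3\psi'(-rCA'+rAC'-2C^2)}{rC^3}\Big)-\frac{2A^3(A-C)\psi'\mathcal{A}'}{rC^2}+\frac{A^4\psi'^2\tilde{\mathcal{C}}''}{C^2}-\frac{\beta A^4\psi'^2}{2C^2}+\kappa^2A^2\mathcal{V}$; $E^{(1)}_{rr}:\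 0=-\frac{(2rAA'+A^2-C^2)\mathcal{A}}{r^2A^2}+\big(\frac{A'}{A}+\frac2r\big)\psi'\tilde{\mathcal{C}}'+\frac{\kappa^2C^2\mathcal{V}}{A^2}+\frac12\beta\psi'^2$; $E^{(1)}_{\vartheta\vartheta}:\ 0=-\frac{A\psi'(rA'+A-C)\mathcal{A}'}{rC^2}+\tilde{\mathcal{C}}'\Big(\frac{A\psi'(rCA'-rAC'+C^2)}{rC^3}+\frac{A^2\psi''}{C^2}\Big)+\frac{\mathcal{A}(-rCA'^2+A(rA'C'-C(rA''+2A'))+A^2C')}{rC^3}+\frac{A^2\psi'^2\tilde{\mathcal{C}}''}{C^2}-\frac{\beta A^2\psi'^2}{2C^2}+\kappa^2\mathcal{V}$; $E^{(1)}_{\psi}:\ 0=\frac{(A-C)(2rA'+A-C)\mathcal{A}'}{r^2C^2}+\frac{\beta A\psi'(2rCA'+A(2C-rC'))}{rC^3}+\frac{\beta A^2\psi''}{C^2}+\kappa^2\mathcal{V}'+\frac{\tilde{\mathcal{C}}'(rCA'(rA'-2C)+A(-r^2A'C'+rC(rA''+6A')-2C^2)+2A^2(C-rC'))}{r^2C^3}$. *)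

theory Defs
  imports "HOL-Analysis.Analysis"
begin

text \<open>Reduced vacuum field equations (real tetrad) of the scalar-torsion theory for
  the metric ansatz ds^2 = A^2 dt^2 - C^2/A^2 dr^2 - r^2 dOmega^2, psi = psi(r).
  Arguments: metric functions A C, scalar field psi (functions of r), coupling
  functions cA (calligraphic A), cC (tilde C), cV (calligraphic V) of psi,
  constants beta, kappa, and radius r. Each definition is the right-hand side of
  the corresponding equation 0 = ... ; derivatives are genuine derivatives.\<close>

definition E_tt :: "(real\<Rightarrow>real) \<Rightarrow> (real\<Rightarrow>real) \<Rightarrow> (real\<Rightarrow>real) \<Rightarrow> (real\<Rightarrow>real) \<Rightarrow> (real\<Rightarrow>real) \<Rightarrow> (real\<Rightarrow>real) \<Rightarrow> real \<Rightarrow> real \<Rightarrow> real \<Rightarrow> real" where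
  "E_tt A C psi cA cC cV beta kappa r =
    (let a = A r; a1 = deriv A r; c = C r; c1 = deriv C r;
         p = psi r; p1 = deriv psi r; p2 = deriv (deriv psi) r;
         fA = cA p; fA1 = deriv cA p; fC1 = deriv cC p; fC2 = deriv (deriv cC) p; fV = cV p
     in fA * (a^2 * (-2*r*a*c*a1 - a^2*(c - 2*r*c1) + c^3)) / (r^2 * c^3)
        + fC1 * (a^4 * p2 / c^2 - a^3 * p1 * (-r*c*a1 + r*a*c1 - 2*c^2) / (r * c^3))
        - 2 * a^3 * (a - c) * p1 * fA1 / (r * c^2)
        + a^4 * p1^2 * fC2 / c^2
        - beta * a^4 * p1^2 / (2 * c^2)
        + kappa^2 * a^2 * fV)"

definition E_rr :: "(real\<Rightarrow>real) \<Rightarrow> (real\<Rightarrow>real) \<Rightarrow> (real\<Rightarrow>real) \<Rightarrow> (real\<Rightarrow>real) \<Rightarrow> (real\<Rightarrow>real) \<Rightarrow> (real\<Rightarrow>real) \<Rightarrow> real \<Rightarrow> real \<Rightarrow> real \<Rightarrow> real" where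
  "E_rr A C psi cA cC cV beta kappa r =
    (let a = A r; a1 = deriv A r; c = C r;
         p = psi r; p1 = deriv psi r;
         fA = cA p; fC1 = deriv cC p; fV = cV p
     in - ((2*r*a*a1 + a^2 - c^2) * fA) / (r^2 * a^2)
        + (a1 / a + 2 / r) * p1 * fC1
        + kappa^2 * c^2 * fV / a^2
        + 1/2 * beta * p1^2)"

definition E_thth :: "(real\<Rightarrow>real) \<Rightarrow> (real\<Rightarrow>real) \<Rightarrow> (real\<Rightarrow>real) \<Rightarrow> (real\<Rightarrow>real) \<Rightarrow> (real\<Rightarrow>real) \<Rightarrow> (real\<Rightarrow>real) \<Rightarrow> real \<Rightarrow> real \<Rightarrow> real \<Rightarrow> real" where
  "E_thth A C psi cA cC cV beta kappa r =
    (let a = A r; a1 = deriv A r; a2 = deriv (deriv A) r; c = C r; c1 = deriv C r;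
         p = psi r; p1 = deriv psi r; p2 = deriv (deriv psi) r;
         fA = cA p; fA1 = deriv cA p; fC1 = deriv cC p; fC2 = deriv (deriv cC) p; fV = cV p
     in - a * p1 * (r*a1 + a - c) * fA1 / (r * c^2)
        + fC1 * (a * p1 * (r*c*a1 - r*a*c1 + c^2) / (r * c^3) + a^2 * p2 / c^2)
        + fA * (-r*c*a1^2 + a*(r*a1*c1 - c*(r*a2 + 2*a1)) + a^2*c1) / (r * c^3)
        + a^2 * p1^2 * fC2 / c^2
        - beta * a^2 * p1^2 / (2 * c^2)
        + kappa^2 * fV)"

definition E_psi :: "(real\<Rightarrow>real) \<Rightarrow> (real\<Rightarrow>real) \<Rightarrow> (real\<Rightarrow>real) \<Rightarrow> (real\<Rightarrow>real) \<Rightarrow> (real\<Rightarrow>real) \<Rightarrow> (real\<Rightarrow>real) \<Rightarrow> real \<Rightarrow> real \<Rightarrow> real \<Rightarrow> real" where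
  "E_psi A C psi cA cC cV beta kappa r =
    (let a = A r; a1 = deriv A r; a2 = deriv (deriv A) r; c = C r; c1 = deriv C r;
         p = psi r; p1 = deriv psi r; p2 = deriv (deriv psi) r;
         fA1 = deriv cA p; fC1 = deriv cC p; fV1 = deriv cV p
     in (a - c) * (2*r*a1 + a - c) * fA1 / (r^2 * c^2)
        + beta * a * p1 * (2*r*c*a1 + a*(2*c - r*c1)) / (r * c^3)
        + beta * a^2 * p2 / c^2
        + kappa^2 * fV1
        + fC1 * (r*c*a1*(r*a1 - 2*c) + a*(- (r^2*a1*c1) + r*c*(r*a2 + 6*a1) - 2*c^2)
                 + 2*a^2*(c - r*c1)) / (r^2 * c^3))"

end

theory Submission
  imports Defs
begin

text \<open>With \<open>C \<equiv> 1\<close> and \<open>\<tilde>C \<equiv> 0\<close> every term carrying \<open>C'\<close> or a derivative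
  of \<open>\<tilde>C\<close> drops out. The scalar field is a constant times \<open>q = A powr (-5/4)\<close> with
  \<open>A = 1 - K r\<^sup>2\<close>, and its first two derivatives are \<open>q\<close> times rational functions of
  \<open>r\<close>, \<open>K\<close>, \<open>A\<close>. Each field equation therefore becomes a rational identity in
  \<open>r, K, A, q\<close>, which holds modulo the relation \<open>K r\<^sup>2 = 1 - A\<close>.\<close>

lemma has_real_derivative_powr_quadric:
  fixes K c e x :: real
  assumes "0 < 1 - K * x^2"
  shows "((\<lambda>r. c * (1 - K * r^2) powr e) has_real_derivative
           -2 * c * e * K * x * (1 - K * x^2) powr e / (1 - K * x^2)) (at x)"
proof -
  have "((\<lambda>r. 1 - K * r^2) has_real_derivative -(2 * K * x)) (at x)"
    by (auto intro!: derivative_eq_intros)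
  from DERIV_cmult[OF DERIV_fun_powr[OF this assms, of e], of c] show ?thesis
    using assms by (simp add: powr_diff field_simps)
qed

lemma deriv_powr_quadric:
  fixes K c e x :: real
  assumes "0 < 1 - K * x^2"
  shows "deriv (\<lambda>r. c * (1 - K * r^2) powr e) x =
           -2 * c * e * K * x * (1 - K * x^2) powr e / (1 - K * x^2)"
  using has_real_derivative_powr_quadric[OF assms] by (rule DERIV_imp_deriv)

lemma deriv2_powr_quadric:
  fixes K c e x :: real
  assumes "0 < 1 - K * x^2"
  shows "deriv (deriv (\<lambda>r. c * (1 - K * r^2) powr e)) x =
           -2 * c * e * K * (1 - K * x^2) powr e / (1 - K * x^2)
           + 4 * c * e * (e - 1) * K^2 * x^2 * (1 - K * x^2) powr e / (1 - K * x^2)^2"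
proof -
  have "open {r. 0 < 1 - K * r^2}"
    by (auto intro!: open_Collect_less continuous_intros)
  then have "eventually (\<lambda>r. 0 < 1 - K * r^2) (nhds x)"
    using assms eventually_nhds_in_open by fastforce
  then have "eventually (\<lambda>r. deriv (\<lambda>r. c * (1 - K * r^2) powr e) r =
               (-2 * c * e * K) * (r * (1 - K * r^2) powr (e - 1))) (nhds x)"
    by (rule eventually_mono) (simp add: deriv_powr_quadric powr_diff)
  then have "deriv (deriv (\<lambda>r. c * (1 - K * r^2) powr e)) x =
               deriv (\<lambda>r. (-2 * c * e * K) * (r * (1 - K * r^2) powr (e - 1))) x"
    by (rule deriv_cong_ev) simp
  also have "\<dots> = (-2 * c * e * K) * ((1 - K * x^2) powr (e - 1)
                    + x * (-2 * (e - 1) * K * x * (1 - K * x^2) powr (e - 1) / (1 - K * x^2)))"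
    using DERIV_cmult[OF DERIV_mult[OF DERIV_ident
            has_real_derivative_powr_quadric[OF assms, of 1 "e - 1"]], of "-2 * c * e * K"]
    by (intro DERIV_imp_deriv) (simp add: algebra_simps)
  also have "\<dots> = -2 * c * e * K * (1 - K * x^2) powr e / (1 - K * x^2)
           + 4 * c * e * (e - 1) * K^2 * x^2 * (1 - K * x^2) powr e / (1 - K * x^2)^2"
  proof -
    define Q where "Q = 1 - K * x^2"
    have "Q > 0" using assms by (simp add: Q_def)
    moreover have powr_pred: "Q powr (e - 1) = Q powr e / Q"
      using \<open>Q > 0\<close> by (simp add: powr_diff)
    ultimately show ?thesis
      unfolding Q_def[symmetric] powr_pred by (simp add: field_simps power2_eq_square)
  qed
  finally show ?thesis .
qed

lemma deriv_scaled_square: "deriv (\<lambda>p::real. a * p^2) x = 2 * a * x"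
  by (rule DERIV_imp_deriv) (auto intro!: derivative_eq_intros)

lemma divide_powr_eq_mult_powr_minus:
  fixes c d x a :: real
  shows "c / (d * x powr a) = c / d * x powr (- a)"
  by (simp add: powr_minus_divide)

lemma E_tt_unit_C_no_coupling:
  "E_tt A (\<lambda>_. 1) psi cA (\<lambda>_. 0) cV beta kappa r =
     cA (psi r) * A r^2 * (1 - A r^2 - 2 * r * A r * deriv A r) / r^2
     - 2 * A r^3 * (A r - 1) * deriv psi r * deriv cA (psi r) / r
     - beta * A r^4 * (deriv psi r)^2 / 2
     + kappa^2 * A r^2 * cV (psi r)"
  by (simp add: E_tt_def Let_def algebra_simps)

lemma E_rr_unit_C_no_coupling:
  "E_rr A (\<lambda>_. 1) psi cA (\<lambda>_. 0) cV beta kappa r =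
     (1 - A r^2 - 2 * r * A r * deriv A r) * cA (psi r) / (r^2 * A r^2)
     + kappa^2 * cV (psi r) / A r^2
     + beta * (deriv psi r)^2 / 2"
  by (simp add: E_rr_def Let_def algebra_simps)

lemma E_thth_unit_C_no_coupling:
  "E_thth A (\<lambda>_. 1) psi cA (\<lambda>_. 0) cV beta kappa r =
     - A r * deriv psi r * (r * deriv A r + A r - 1) * deriv cA (psi r) / r
     + cA (psi r) * (- r * (deriv A r)^2 - A r * (r * deriv (deriv A) r + 2 * deriv A r)) / r
     - beta * A r^2 * (deriv psi r)^2 / 2
     + kappa^2 * cV (psi r)"
  by (simp add: E_thth_def Let_def algebra_simps)

lemma E_psi_unit_C_no_coupling:
  "E_psi A (\<lambda>_. 1) psi cA (\<lambda>_. 0) cV beta kappa r =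
     (A r - 1) * (2 * r * deriv A r + A r - 1) * deriv cA (psi r) / r^2
     + 2 * beta * A r * deriv psi r * (r * deriv A r + A r) / r
     + beta * A r^2 * deriv (deriv psi) r
     + kappa^2 * deriv cV (psi r)"
  by (simp add: E_psi_def Let_def algebra_simps)

theorem mainTheorem5:
  fixes beta psi0 kappa K :: real
  assumes "kappa > 0" and "K \<noteq> 0"
  defines "A \<equiv> (\<lambda>r::real. 1 - K * r^2)"
      and "C \<equiv> (\<lambda>r::real. 1::real)"
      and "psi \<equiv> (\<lambda>r::real. 2 * psi0 / (5 * K * (1 - K * r^2) powr (5/4)))"
      and "cA \<equiv> (\<lambda>p::real. 5 * beta / 8 * p^2)"
      and "cC \<equiv> (\<lambda>p::real. 0::real)"
      and "cV \<equiv> (\<lambda>p::real. - (15 * K * beta / (4 * kappa^2)) * p^2)"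
  shows "\<forall>r \<in> {r::real. r > 0 \<and> 1 - K * r^2 > 0}.
           E_tt A C psi cA cC cV beta kappa r = 0 \<and>
           E_rr A C psi cA cC cV beta kappa r = 0 \<and>
           E_thth A C psi cA cC cV beta kappa r = 0 \<and>
           E_psi A C psi cA cC cV beta kappa r = 0"
proof
  fix r assume "r \<in> {r::real. r > 0 \<and> 1 - K * r^2 > 0}"
  then have "r > 0" and pos: "0 < 1 - K * r^2" by auto
  define U where "U = 1 - K * r^2"
  define q where "q = U powr (- (5/4))"
  have "U > 0" and Kr: "K * r^2 = 1 - U" using pos by (simp_all add: U_def)
  have psi_powr: "psi = (\<lambda>r. 2 * psi0 / (5 * K) * (1 - K * r^2) powr (- (5/4)))"
    unfolding psi_def divide_powr_eq_mult_powr_minus ..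
  have "deriv A = (\<lambda>r. -2 * K * r)"
    unfolding A_def by (rule ext, rule DERIV_imp_deriv) (auto intro!: derivative_eq_intros)
  then have dA: "deriv A r = -2 * K * r" and ddA: "deriv (deriv A) r = -2 * K"
    by simp_all
  have Ar: "A r = U" and psir: "psi r = 2 * psi0 / (5 * K) * q"
    unfolding A_def psi_powr U_def q_def by simp_all
  have dpsi: "deriv psi r = psi0 * r * q / U"
    unfolding psi_powr deriv_powr_quadric[OF pos] U_def[symmetric] q_def[symmetric]
    using assms(2) by simp
  have ddpsi: "deriv (deriv psi) r = psi0 * q / U + 9/2 * psi0 * K * r^2 * q / U^2"
    unfolding psi_powr deriv2_powr_quadric[OF pos] U_def[symmetric] q_def[symmetric]
    using assms(2) \<open>U > 0\<close> by (simp add: field_simps power2_eq_square)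
  have dcA: "deriv cA p = 5 * beta / 4 * p"
    and dcV: "deriv cV p = - (15 * K * beta / (2 * kappa^2)) * p" for p
    unfolding cA_def cV_def deriv_scaled_square by simp_all
  note point_values = Ar dA ddA psir dpsi ddpsi dcA dcV
  show "E_tt A C psi cA cC cV beta kappa r = 0 \<and>
        E_rr A C psi cA cC cV beta kappa r = 0 \<and>
        E_thth A C psi cA cC cV beta kappa r = 0 \<and>
        E_psi A C psi cA cC cV beta kappa r = 0"
    unfolding C_def cC_def E_tt_unit_C_no_coupling E_rr_unit_C_no_coupling
      E_thth_unit_C_no_coupling E_psi_unit_C_no_coupling point_values
    unfolding cA_def cV_def
    using \<open>r > 0\<close> \<open>U > 0\<close> assms(1,2) Kr by (intro conjI; simp add: field_simps; algebra)
qed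

end
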